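(* Let $\mathit{accel}$ be the partial function defined on exactly those pairs $(\langle\chi,\vec a\rangle,\check\phi)$ (a loop and a quantifier-free formula over $\vec x$) for which \[ \check\phi(\vec x)\land\chi(\vec a(\vec x))\implies\chi(\vec x) \] is valid, by \[ \mathit{accel}(\langle\chi,\vec a\rangle,\check\phi):=\bigl(\vec x'=\vec a^n(\vec x)\land\chi(\vec a^{n-1}(\vec x))\bigr). \] Then $\mathit{accel}$ is an exact conditional acceleration technique.
   Context: Fix $d\ge 1$, integer variables $\vec x=(x_1,\dots,x_d)$, $\vec x'$, and $n$ ranging over $\mathbb N$; $\vec y=(\vec x,n,\vec x')$. A loop $\langle\chi,\vec a\rangle$ consists of a quantifier-free formula $\chi$ over atoms $p>0$ ($p$ an arithmetic expression over $\vec x$, integer semantics) and a map $\vec a:\mathbb Z^d\to\mathbb Z^d$ given by expressions over $\vec x$; $\vec a^0(\vec x)=\vec x$, $\vec a^{m+1}(\vec x)=\vec a(\vec a^m(\vec x))$. $\vec x\longrightarrow_{\langle\chi,\vec a\rangle}\vec x'$ iff $\chi(\vec x)\land\vec x'=\vec a(\vec x)$, and $\longrightarrow^m$ is its $m$-fold composition. A conditional acceleration technique is a partial function $\mathit{accel}$ from pairs (loop $\langle\chi,\vec a\rangle$, quantifier-free formula $\check\phi$ over $\vec x$) to formulas over $\vec y$. It is sound if for all arguments in its domain, all $\vec x,\vec x'\in\mathbb Z^d$ and all $n>0$, $\vec x\longrightarrow^n_{\langle\check\phi,\vec a\rangle}\vec x'\land\mathit{accel}(\langle\chi,\vec a\rangle,\check\phi)$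 implies $\vec x\longrightarrow^n_{\langle\chi,\vec a\rangle}\vec x'$; it is exact if it is sound and additionally $\vec x\longrightarrow^n_{\langle\chi\land\check\phi,\vec a\rangle}\vec x'$ implies $\mathit{accel}(\langle\chi,\vec a\rangle,\check\phi)$ for all such arguments. Validity means truth for all integer values of the free variables. *)

theory Defs
  imports Main "HOL-Analysis.Finite_Cartesian_Product"
begin

text \<open>
  The \<open>d \<ge> 1\<close> program variables are indexed by a finite type \<open>'d\<close>, and a state is a vector
  in \<open>int ^ 'd\<close>.

  Division and exponentiation are made total over the integers: \<^term>\<open>(div)\<close> is exact whenever
  the quotient is an integer, and \<open>a ^ nat b\<close> is the usual power whenever \<open>b \<ge> 0\<close>.
\<close>

datatype 'd aexp =
    Var 'd
  | Const int
  | Add "'d aexp" "'d aexp"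
  | Sub "'d aexp" "'d aexp"
  | Mult "'d aexp" "'d aexp"
  | Div "'d aexp" "'d aexp"
  | Pow "'d aexp" "'d aexp"

primrec aval :: "'d::finite aexp \<Rightarrow> int ^ 'd \<Rightarrow> int" where
  "aval (Var i) x = x $ i"
| "aval (Const k) x = k"
| "aval (Add p q) x = aval p x + aval q x"
| "aval (Sub p q) x = aval p x - aval q x"
| "aval (Mult p q) x = aval p x * aval q x"
| "aval (Div p q) x = aval p x div aval q x"
| "aval (Pow p q) x = aval p x ^ nat (aval q x)"

text \<open>Quantifier-free formulas; \<open>Pos p\<close> is the atom \<open>p > 0\<close>.\<close>

datatype 'd qf =
    Pos "'d aexp"
  | Neg "'d qf"
  | Conj "'d qf" "'d qf"
  | Disj "'d qf" "'d qf"

primrec holds :: "'d::finite qf \<Rightarrow> int ^ 'd \<Rightarrow> bool" where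
  "holds (Pos p) x \<longleftrightarrow> aval p x > 0"
| "holds (Neg f) x \<longleftrightarrow> \<not> holds f x"
| "holds (Conj f g) x \<longleftrightarrow> holds f x \<and> holds g x"
| "holds (Disj f g) x \<longleftrightarrow> holds f x \<or> holds g x"

text \<open>A loop is a guard together with one expression per variable for its update.\<close>

type_synonym 'd loop = "'d qf \<times> ('d \<Rightarrow> 'd aexp)"

definition update :: "('d::finite \<Rightarrow> 'd aexp) \<Rightarrow> int ^ 'd \<Rightarrow> int ^ 'd" where
  "update a x = (\<chi> i. aval (a i) x)"

definition loop_step :: "'d::finite loop \<Rightarrow> int ^ 'd \<Rightarrow> int ^ 'd \<Rightarrow> bool" where
  "loop_step L x x' \<longleftrightarrow> holds (fst L) x \<and> x' = update (snd L) x"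

text \<open>
  Formulas over \<open>(x, n, x')\<close> are represented by their meaning: the iterate of an update for a
  symbolic exponent \<open>n\<close> need not be an arithmetic expression over \<open>x\<close> and \<open>n\<close>.
\<close>

type_synonym 'd formula = "int ^ 'd \<Rightarrow> nat \<Rightarrow> int ^ 'd \<Rightarrow> bool"

type_synonym 'd cond_accel = "('d loop \<times> 'd qf) \<rightharpoonup> 'd formula"

definition sound :: "'d::finite cond_accel \<Rightarrow> bool" where
  "sound accel \<longleftrightarrow>
    (\<forall>c a \<phi> \<psi>. accel ((c, a), \<phi>) = Some \<psi> \<longrightarrow>
      (\<forall>x x' n. n > 0 \<longrightarrow>
        (loop_step (\<phi>, a) ^^ n) x x' \<and> \<psi> x n x' \<longrightarrow> (loop_step (c, a) ^^ n) x x'))"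

definition exact :: "'d::finite cond_accel \<Rightarrow> bool" where
  "exact accel \<longleftrightarrow>
    sound accel \<and>
    (\<forall>c a \<phi> \<psi>. accel ((c, a), \<phi>) = Some \<psi> \<longrightarrow>
      (\<forall>x x' n. n > 0 \<longrightarrow>
        (loop_step (Conj c \<phi>, a) ^^ n) x x' \<longrightarrow> \<psi> x n x'))"

text \<open>
  Soundness and exactness only concern \<open>n > 0\<close>, so the truncation of \<open>n - 1\<close> at \<open>n = 0\<close> is
  immaterial below.
\<close>

definition accel_decrease :: "'d::finite cond_accel" where
  "accel_decrease = (\<lambda>((c, a), \<phi>).
    if \<forall>x. holds \<phi> x \<and> holds c (update a x) \<longrightarrow> holds c x
    then Some (\<lambda>x n x'. x' = (update a ^^ n) x \<and> holds c ((update a ^^ (n - 1)) x))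
    else None)"

end

theory Submission
  imports Defs
begin

text \<open>
  An \<open>n\<close>-fold run of a loop amounts to the guard holding at the iterates \<open>0, \<dots>, n - 1\<close>. Under
  the premise of the acceleration, validity of \<open>\<chi>\<close> propagates backwards along a run on which
  \<open>\<phi>\<close> holds, so it suffices to know \<open>\<chi>\<close> at iterate \<open>n - 1\<close>.
\<close>

lemma relpowp_loop_step_iff:
  "(loop_step (c, a) ^^ n) x x' \<longleftrightarrow>
    x' = (update a ^^ n) x \<and> (\<forall>i<n. holds c ((update a ^^ i) x))"
proof (induction n arbitrary: x')
  case 0
  show ?case by auto
next
  case (Suc n)
  have "(loop_step (c, a) ^^ Suc n) x x' \<longleftrightarrow>
      (\<exists>y. (loop_step (c, a) ^^ n) x y \<and> loop_step (c, a) y x')"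
    by (simp add: relcompp_apply)
  also have "\<dots> \<longleftrightarrow>
      x' = (update a ^^ Suc n) x \<and> (\<forall>i<Suc n. holds c ((update a ^^ i) x))"
    \<comment> \<open>Steps are deterministic, so the intermediate state \<open>y\<close> can only
      be the \<open>n\<close>-th iterate; the last step then contributes the guard at index
      \<open>n\<close>.\<close>
    unfolding Suc.IH by (auto simp: loop_step_def less_Suc_eq)
  finally show ?case .
qed

text \<open>Downward induction from \<open>m\<close>: \<phi> at iterate \<open>j\<close> and
  \<open>c\<close> at iterate \<open>j + 1\<close> give \<open>c\<close> at iterate
  \<open>j\<close>, so \<phi> is only asked for strictly below \<open>m\<close>.\<close>

lemma holds_iterate_backward:
  assumes dec: "\<And>y. holds \<phi> y \<Longrightarrow> holds c (update a y) \<Longrightarrow> holds c y"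
    and "i \<le> m" and "holds c ((update a ^^ m) x)"
    and "\<forall>j<m. holds \<phi> ((update a ^^ j) x)"
  shows "holds c ((update a ^^ i) x)"
  using \<open>i \<le> m\<close>
proof (induction rule: inc_induct)
  case base
  show ?case by fact
next
  case (step j)
  then show ?case using assms(4) dec[of "(update a ^^ j) x"] by simp
qed

lemma accel_decrease_eq_Some_iff:
  "accel_decrease ((c, a), \<phi>) = Some \<psi> \<longleftrightarrow>
    (\<forall>y. holds \<phi> y \<and> holds c (update a y) \<longrightarrow> holds c y) \<and>
    \<psi> = (\<lambda>x n x'. x' = (update a ^^ n) x \<and> holds c ((update a ^^ (n - 1)) x))"
  unfolding accel_decrease_def prod.case by auto

theorem theorem7: "exact (accel_decrease :: 'd::finite cond_accel)"
  unfolding exact_def sound_def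
proof (intro conjI allI impI; (elim conjE)?)
  fix c \<phi> :: "'d qf" and a \<psi> x x' and n :: nat
  assume def: "accel_decrease ((c, a), \<phi>) = Some \<psi>" and "n > 0"
    and run: "(loop_step (\<phi>, a) ^^ n) x x'" and "\<psi> x n x'"
  have dec: "\<And>y. holds \<phi> y \<Longrightarrow> holds c (update a y) \<Longrightarrow> holds c y"
    and last: "holds c ((update a ^^ (n - 1)) x)"
    using def \<open>\<psi> x n x'\<close> unfolding accel_decrease_eq_Some_iff by blast+
  have "holds c ((update a ^^ i) x)" if "i < n" for i
  \<comment> \<open>The descent starts at iterate \<open>n - 1\<close>, the last state where a guard
    is checked and the one where \<psi> supplies \<open>c\<close>.\<close>
  proof (rule holds_iterate_backward[OF dec _ last])
    show "i \<le> n - 1" using \<open>i < n\<close> by simp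
    show "\<forall>j<n - 1. holds \<phi> ((update a ^^ j) x)"
      using run unfolding relpowp_loop_step_iff by simp
  qed
  then show "(loop_step (c, a) ^^ n) x x'"
    using run by (simp add: relpowp_loop_step_iff)
next
  fix c \<phi> :: "'d qf" and a \<psi> x x' and n :: nat
  assume def: "accel_decrease ((c, a), \<phi>) = Some \<psi>" and "n > 0"
    and run: "(loop_step (Conj c \<phi>, a) ^^ n) x x'"
  have "\<psi> = (\<lambda>x n x'. x' = (update a ^^ n) x \<and> holds c ((update a ^^ (n - 1)) x))"
    using def unfolding accel_decrease_eq_Some_iff by blast
  \<comment> \<open>Since \<open>n > 0\<close>, the index \<open>n - 1\<close> is among those at
    which the run checks \<open>Conj c \<phi>\<close>.\<close>
  then show "\<psi> x n x'"
    using run \<open>n > 0\<close> by (simp add: relpowp_loop_step_iff)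
qed

end
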